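(* Let $R$ be either a not necessarily commutative ring $\mathcal{K}$ with associative powers, or a not necessarily commutative and not necessarily associative ring $\mathfrak{K}$, in each case with division by integers, and let $n\ge1$. For $n\times n$ matrices $A$ over $R$: (b) $edet(A)$ is an antisymmetric function of the rows and of the columns of $A$ (interchanging two distinct rows, or two distinct columns, changes $edet(A)$ to $-edet(A)$); (c) $edet(A)=0$ if $A$ contains a zero row or a zero column; (d) $edet(A)=0$ if $A$ contains two equal rows or two equal columns; (e) $edet(A)=edet(A^T)$. Moreover, the Laplace expansion formulas, the polyadditivity of $edet$ in the rows and columns of $A$ (additivity in each row, respectively column, when the others are fixed), and the formula $edet(AB)=edet(A)\,edet(B)$ are not valid in general, i.e. they do not hold for all such rings, all $n$, and all $n\times n$ matrices.
   Context: Rings have biadditive multiplication and are not assumed to have a unit. A ring is "with division by integers" if for every nonzero integer $m$ the map $x\mapsto mx$ is bijective on the ring; $\frac1m x$ denotes the inverse image of $x$. A ring has associative powers if every power $a^n$ of a single element is independent of the arrangement of brackets. $S_n^{(e)}$, $S_n^{(o)}$ are the sets of even and odd permutations of $\{1,\dots,n\}$. For $A=(a_{ij})$, a permutation $\sigma$ and $1\le i_1<\dots<i_k\le n$, the sequence $l=(a_{i_1\sigma(i_1)},\dots,a_{i_k\sigma(i_k)})$ is a subdiagonal of length $k$ of the diagonal $(a_{1\sigma(1)},\dots,a_{n\sigma(n)})$; subdiagonals are identified by their positions $\{(i_1,\sigma(i_1)),\dots,(i_k,\sigma(i_k))\}$ in the matrix (not merely by the values of the entries). $L_k^{(e)}$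 (respectively $L_k^{(o)}$) is the set of all subdiagonals of length $k$ of diagonals with $\sigma\in S_n^{(e)}$ (respectively $\sigma\in S_n^{(o)}$), and $su(l)=\sum_{s=1}^k a_{i_s\sigma(i_s)}$. For $n=1$, $L_0^{(e)}$ consists of the empty subdiagonal, with $su=0$, and $L_0^{(o)}=\emptyset$. Over $\mathcal{K}$, $$edet(A)=\frac{-1}{n!}\Big\{\sum_{l\in L_{n-1}^{(e)}}su(l)^n-\sum_{l\in L_{n-1}^{(o)}}su(l)^n+\sum_{l\in L_n^{(o)}}su(l)^n-\sum_{l\in L_n^{(e)}}su(l)^n\Big\}.$$ Over $\mathfrak{K}$, $edet(A)$ is defined by the same formula with each $su(l)^n$ replaced by $Ass(su(l)^n)$, where for $a\in\mathfrak{K}$, $Ass(a^n)$ is $\frac1{C_n}$ times the sum, over all $C_n=\frac{(2n-2)!}{n!\,(n-1)!}$ arrangements of brackets in the $n$-fold product $a\times a\times\cdots\times a$, of the resulting products. The Laplace expansion formulas are $edet(A)=\sum_{j=1}^n(-1)^{i+j}a_{ij}\,edet(A_{ij})$ (row $i$) and $edet(A)=\sum_{i=1}^n(-1)^{i+j}a_{ij}\,edet(A_{ij})$ (column $j$), where $n\ge2$ and $A_{ij}$ is $A$ with row $i$ and column $j$ deleted.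
   Formalization: Failure of polyadditivity is not asserted on its own, since edet is in fact additive in each row and column over every such ring; it appears only in the claim that the Laplace formulas, polyadditivity and edet(AB)=edet(A)edet(B) do not all hold together. *)

theory Defs
  imports Complex_Main
    "HOL-Library.Product_Plus"
    "HOL-Combinatorics.Permutations"
    "Jordan_Normal_Form.Determinant"
begin

section \<open>Rings without unit, with division by integers\<close>

text \<open>
  The additive group of a ring is the type \<open>'a :: ab_group_add\<close>; its multiplication is an
  explicit function \<open>mul\<close>, assumed neither associative nor commutative nor unital.
\<close>

definition int_multiple :: "int \<Rightarrow> 'a::ab_group_add \<Rightarrow> 'a" where
  "int_multiple m x = (if m \<ge> 0 then (\<Sum>i<nat m. x) else - (\<Sum>i<nat (- m). x))"

definition int_divide :: "int \<Rightarrow> 'a::ab_group_add \<Rightarrow> 'a" where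
  "int_divide m x = inv_into UNIV (int_multiple m) x"

definition biadditive :: "('a::ab_group_add \<Rightarrow> 'a \<Rightarrow> 'a) \<Rightarrow> bool" where
  "biadditive mul \<longleftrightarrow>
     (\<forall>x y z. mul (x + y) z = mul x z + mul y z) \<and>
     (\<forall>x y z. mul x (y + z) = mul x y + mul x z)"

definition ring_int_division :: "('a::ab_group_add \<Rightarrow> 'a \<Rightarrow> 'a) \<Rightarrow> bool" where
  "ring_int_division mul \<longleftrightarrow>
     biadditive mul \<and> (\<forall>m. m \<noteq> 0 \<longrightarrow> bij (int_multiple m :: 'a \<Rightarrow> 'a))"


section \<open>Arrangements of brackets and powers\<close>

text \<open>
  An arrangement of brackets in an \<open>n\<close>-fold product is a binary tree with \<open>n\<close> leaves.
\<close>

datatype bracketing = Factor | Prod bracketing bracketing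

primrec factors :: "bracketing \<Rightarrow> nat" where
  "factors Factor = 1"
| "factors (Prod s t) = factors s + factors t"

primrec bracket_power :: "('a \<Rightarrow> 'a \<Rightarrow> 'a) \<Rightarrow> 'a \<Rightarrow> bracketing \<Rightarrow> 'a" where
  "bracket_power mul a Factor = a"
| "bracket_power mul a (Prod s t) = mul (bracket_power mul a s) (bracket_power mul a t)"

definition associative_powers :: "('a \<Rightarrow> 'a \<Rightarrow> 'a) \<Rightarrow> bool" where
  "associative_powers mul \<longleftrightarrow>
     (\<forall>a s t. factors s = factors t \<longrightarrow> bracket_power mul a s = bracket_power mul a t)"

text \<open>
  \<open>ring_power mul n a\<close> is the left-normed power, which is the power \<open>a ^ n\<close> if \<open>mul\<close> has associative
  powers. Only \<open>n \<ge> 1\<close> is meaningful, as there is no unit; the value at \<open>0\<close> is arbitrary.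
\<close>

fun ring_power :: "('a::ab_group_add \<Rightarrow> 'a \<Rightarrow> 'a) \<Rightarrow> nat \<Rightarrow> 'a \<Rightarrow> 'a" where
  "ring_power mul 0 a = 0"
| "ring_power mul (Suc 0) a = a"
| "ring_power mul (Suc (Suc n)) a = mul (ring_power mul (Suc n) a) a"

definition bracketing_count :: "nat \<Rightarrow> nat" where
  "bracketing_count n = fact (2 * n - 2) div (fact n * fact (n - 1))"

definition Ass_power :: "('a::ab_group_add \<Rightarrow> 'a \<Rightarrow> 'a) \<Rightarrow> nat \<Rightarrow> 'a \<Rightarrow> 'a" where
  "Ass_power mul n a =
     int_divide (int (bracketing_count n)) (\<Sum>t | factors t = n. bracket_power mul a t)"


section \<open>Subdiagonals and the determinant edet\<close>

text \<open>
  Indices run over \<open>{0..<n}\<close>. Shifting both indices by one does not change the signs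
  \<open>(-1) ^ (i + j)\<close>. A subdiagonal is represented by its set of positions.
\<close>

definition diagonal :: "nat \<Rightarrow> (nat \<Rightarrow> nat) \<Rightarrow> (nat \<times> nat) set" where
  "diagonal n \<sigma> = {(i, \<sigma> i) | i. i < n}"

definition subdiagonals_even :: "nat \<Rightarrow> nat \<Rightarrow> (nat \<times> nat) set set" where
  "subdiagonals_even n k =
     {l. card l = k \<and> (\<exists>\<sigma>. \<sigma> permutes {0..<n} \<and> evenperm \<sigma> \<and> l \<subseteq> diagonal n \<sigma>)}"

definition subdiagonals_odd :: "nat \<Rightarrow> nat \<Rightarrow> (nat \<times> nat) set set" where
  "subdiagonals_odd n k =
     {l. card l = k \<and> (\<exists>\<sigma>. \<sigma> permutes {0..<n} \<and> \<not> evenperm \<sigma> \<and> l \<subseteq> diagonal n \<sigma>)}"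

definition su :: "'a::ab_group_add mat \<Rightarrow> (nat \<times> nat) set \<Rightarrow> 'a" where
  "su A l = (\<Sum>(i, j)\<in>l. A $$ (i, j))"

text \<open>The common formula, for an \<open>n\<close>-th power operation \<open>pwr n\<close>.\<close>

definition edet_of :: "(nat \<Rightarrow> 'a::ab_group_add \<Rightarrow> 'a) \<Rightarrow> 'a mat \<Rightarrow> 'a" where
  "edet_of pwr A = (let n = dim_row A in
     - int_divide (fact n)
         ((\<Sum>l\<in>subdiagonals_even n (n - 1). pwr n (su A l))
        - (\<Sum>l\<in>subdiagonals_odd n (n - 1). pwr n (su A l))
        + (\<Sum>l\<in>subdiagonals_odd n n. pwr n (su A l))
        - (\<Sum>l\<in>subdiagonals_even n n. pwr n (su A l))))"

text \<open>\<open>edet\<close> is meant for rings with associative powers, \<open>edet_Ass\<close> for arbitrary ones.\<close>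

definition edet :: "('a::ab_group_add \<Rightarrow> 'a \<Rightarrow> 'a) \<Rightarrow> 'a mat \<Rightarrow> 'a" where
  "edet mul = edet_of (ring_power mul)"

definition edet_Ass :: "('a::ab_group_add \<Rightarrow> 'a \<Rightarrow> 'a) \<Rightarrow> 'a mat \<Rightarrow> 'a" where
  "edet_Ass mul = edet_of (Ass_power mul)"


section \<open>Properties of a function of \<open>n \<times> n\<close> matrices\<close>

definition antisymmetric_mat_fun :: "nat \<Rightarrow> ('a::ab_group_add mat \<Rightarrow> 'a) \<Rightarrow> bool" where
  "antisymmetric_mat_fun n D \<longleftrightarrow>
     (\<forall>A\<in>carrier_mat n n. \<forall>k<n. \<forall>l<n. k \<noteq> l \<longrightarrow>
        D (swaprows k l A) = - D A \<and> D (swapcols k l A) = - D A)"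

definition vanishes_zero_line :: "nat \<Rightarrow> ('a::ab_group_add mat \<Rightarrow> 'a) \<Rightarrow> bool" where
  "vanishes_zero_line n D \<longleftrightarrow>
     (\<forall>A\<in>carrier_mat n n. \<forall>k<n. row A k = 0\<^sub>v n \<or> col A k = 0\<^sub>v n \<longrightarrow> D A = 0)"

definition vanishes_equal_lines :: "nat \<Rightarrow> ('a::ab_group_add mat \<Rightarrow> 'a) \<Rightarrow> bool" where
  "vanishes_equal_lines n D \<longleftrightarrow>
     (\<forall>A\<in>carrier_mat n n. \<forall>k<n. \<forall>l<n. k \<noteq> l \<longrightarrow>
        row A k = row A l \<or> col A k = col A l \<longrightarrow> D A = 0)"

definition transpose_invariant :: "nat \<Rightarrow> ('a::ab_group_add mat \<Rightarrow> 'a) \<Rightarrow> bool" where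
  "transpose_invariant n D \<longleftrightarrow> (\<forall>A\<in>carrier_mat n n. D A = D (transpose_mat A))"

text \<open>
  The sign \<open>(-1) ^ (i + j)\<close> acts as an integer multiple because the ring has no unit.
\<close>

definition laplace_rows ::
  "nat \<Rightarrow> ('a::ab_group_add \<Rightarrow> 'a \<Rightarrow> 'a) \<Rightarrow> ('a mat \<Rightarrow> 'a) \<Rightarrow> bool" where
  "laplace_rows n mul D \<longleftrightarrow>
     (\<forall>A\<in>carrier_mat n n. \<forall>i<n.
        D A = (\<Sum>j<n. int_multiple ((-1) ^ (i + j)) (mul (A $$ (i, j)) (D (mat_delete A i j)))))"

definition laplace_cols ::
  "nat \<Rightarrow> ('a::ab_group_add \<Rightarrow> 'a \<Rightarrow> 'a) \<Rightarrow> ('a mat \<Rightarrow> 'a) \<Rightarrow> bool" where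
  "laplace_cols n mul D \<longleftrightarrow>
     (\<forall>A\<in>carrier_mat n n. \<forall>j<n.
        D A = (\<Sum>i<n. int_multiple ((-1) ^ (i + j)) (mul (A $$ (i, j)) (D (mat_delete A i j)))))"

text \<open>
  For \<open>edet\<close> and \<open>edet_Ass\<close> this property holds: when the powers are expanded, each word whose
  letters occupy fewer than \<open>n\<close> positions cancels, and words in \<open>n\<close> positions are additive
  in each line. Hence it can only fail in conjunction with other formulas.
\<close>

definition polyadditive :: "nat \<Rightarrow> ('a::ab_group_add mat \<Rightarrow> 'a) \<Rightarrow> bool" where
  "polyadditive n D \<longleftrightarrow>
     (\<forall>A\<in>carrier_mat n n. \<forall>B\<in>carrier_mat n n. \<forall>C\<in>carrier_mat n n. \<forall>k<n.
        (row C k = row A k + row B k \<and>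
           (\<forall>i<n. i \<noteq> k \<longrightarrow> row A i = row C i \<and> row B i = row C i)
           \<longrightarrow> D C = D A + D B) \<and>
        (col C k = col A k + col B k \<and>
           (\<forall>j<n. j \<noteq> k \<longrightarrow> col A j = col C j \<and> col B j = col C j)
           \<longrightarrow> D C = D A + D B))"

definition mat_mult ::
  "nat \<Rightarrow> ('a::ab_group_add \<Rightarrow> 'a \<Rightarrow> 'a) \<Rightarrow> 'a mat \<Rightarrow> 'a mat \<Rightarrow> 'a mat" where
  "mat_mult n mul A B = mat n n (\<lambda>(i, j). \<Sum>k<n. mul (A $$ (i, k)) (B $$ (k, j)))"

definition multiplicative_mat_fun ::
  "nat \<Rightarrow> ('a::ab_group_add \<Rightarrow> 'a \<Rightarrow> 'a) \<Rightarrow> ('a mat \<Rightarrow> 'a) \<Rightarrow> bool" where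
  "multiplicative_mat_fun n mul D \<longleftrightarrow>
     (\<forall>A\<in>carrier_mat n n. \<forall>B\<in>carrier_mat n n. D (mat_mult n mul A B) = mul (D A) (D B))"

text \<open>
  A formula cannot quantify over types, so invalidity in general is stated for rings
  on one fixed additive group, which is stronger than invalidity for rings on arbitrary types.
\<close>

type_synonym rat4 = "rat \<times> rat \<times> rat \<times> rat"

end

theory Submission
  imports Defs
begin

text \<open>
  The four vanishing and symmetry properties hold for every power operation whatsoever: they only
  reflect how exchanging rows, or transposing, acts on the subdiagonals. Laplace expansion and
  multiplicativity fail already for \<open>2 \<times> 2\<close> diagonal matrices, where \<open>edet\<close> is the symmetrized
  product \<open>(pq + qp) / 2\<close> of the diagonal entries: Laplace expansion of \<open>diag(p, q)\<close> would give
  \<open>pq\<close>, and so would multiplicativity for \<open>diag(1, p) diag(q, 1) = diag(q, p)\<close>.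
\<close>

section \<open>Division by integers\<close>

lemma int_multiple_uminus: "int_multiple m (- x) = - int_multiple m x"
  by (simp add: int_multiple_def sum_negf)

lemma int_multiple_zero: "int_multiple m 0 = 0"
  by (simp add: int_multiple_def)

lemma int_multiple_one: "int_multiple 1 x = x"
  by (simp add: int_multiple_def)

lemma int_multiple_two: "int_multiple 2 x = x + x"
  by (simp add: int_multiple_def numeral_2_eq_2)

text \<open>Quotients are evaluated by exhibiting a solution \<open>y\<close>; injectivity of the
  integer multiple identifies it with the value chosen by \<open>inv_into\<close>.\<close>

lemma int_divide_eqI:
  fixes mul :: "'a::ab_group_add \<Rightarrow> 'a \<Rightarrow> 'a"
  assumes "ring_int_division mul" and "m \<noteq> 0" and "int_multiple m y = (x :: 'a)"
  shows "int_divide m x = y"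
proof -
  have "inj (int_multiple m :: 'a \<Rightarrow> 'a)"
    using assms by (auto simp: ring_int_division_def bij_def)
  then show ?thesis
    unfolding int_divide_def assms(3)[symmetric] by (rule inv_f_f)
qed

lemma int_multiple_int_divide:
  fixes mul :: "'a::ab_group_add \<Rightarrow> 'a \<Rightarrow> 'a"
  assumes "ring_int_division mul" and "m \<noteq> 0"
  shows "int_multiple m (int_divide m x) = (x :: 'a)"
proof -
  have "surj (int_multiple m :: 'a \<Rightarrow> 'a)"
    using assms by (auto simp: ring_int_division_def bij_def)
  then show ?thesis
    unfolding int_divide_def by (rule surj_f_inv_f)
qed

lemma int_divide_zero:
  fixes mul :: "'a::ab_group_add \<Rightarrow> 'a \<Rightarrow> 'a"
  assumes "ring_int_division mul" and "m \<noteq> 0"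
  shows "int_divide m (0 :: 'a) = 0"
  by (rule int_divide_eqI[OF assms int_multiple_zero])

lemma int_divide_uminus:
  fixes mul :: "'a::ab_group_add \<Rightarrow> 'a \<Rightarrow> 'a"
  assumes "ring_int_division mul" and "m \<noteq> 0"
  shows "int_divide m (- x :: 'a) = - int_divide m x"
  by (rule int_divide_eqI[OF assms])
    (simp add: int_multiple_uminus int_multiple_int_divide[OF assms])

text \<open>Here \<open>x + x = 0\<close>, so both \<open>x\<close> and 0 are halves of 0. This
  absence of 2-torsion turns antisymmetry into vanishing for equal lines.\<close>

lemma eq_uminus_self_imp_zero:
  fixes mul :: "'a::ab_group_add \<Rightarrow> 'a \<Rightarrow> 'a"
  assumes "ring_int_division mul" and "x = - (x :: 'a)"
  shows "x = 0"
proof -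
  have "int_multiple 2 x = 0"
    using assms(2) by (metis int_multiple_two add.right_inverse)
  then have "int_divide 2 0 = x"
    by (intro int_divide_eqI[OF assms(1)]) simp
  then show ?thesis
    using int_divide_zero[OF assms(1), of 2] by simp
qed


section \<open>Subdiagonals\<close>

text \<open>Parity is a Boolean argument so that an exchange of rows acts on it as
  \<open>Not\<close> and one lemma serves both classes.\<close>

definition subdiagonals :: "bool \<Rightarrow> nat \<Rightarrow> nat \<Rightarrow> (nat \<times> nat) set set" where
  "subdiagonals b n k =
     {l. card l = k \<and> (\<exists>\<sigma>. \<sigma> permutes {0..<n} \<and> evenperm \<sigma> = b \<and> l \<subseteq> diagonal n \<sigma>)}"

text \<open>Grouping the four sums by length lets every symmetry be checked one length at a
  time.\<close>

definition signed_powers :: "('a::ab_group_add \<Rightarrow> 'a) \<Rightarrow> 'a mat \<Rightarrow> nat \<Rightarrow> 'a" where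
  "signed_powers p A k =
     (\<Sum>l\<in>subdiagonals True (dim_row A) k. p (su A l))
   - (\<Sum>l\<in>subdiagonals False (dim_row A) k. p (su A l))"

lemma edet_of_eq:
  "edet_of pwr A = - int_divide (fact (dim_row A))
     (signed_powers (pwr (dim_row A)) A (dim_row A - 1) - signed_powers (pwr (dim_row A)) A (dim_row A))"
proof -
  have "subdiagonals_even n k = subdiagonals True n k"
    "subdiagonals_odd n k = subdiagonals False n k" for n k
    by (auto simp: subdiagonals_def subdiagonals_even_def subdiagonals_odd_def)
  then show ?thesis
    by (simp add: edet_of_def signed_powers_def Let_def algebra_simps)
qed

lemma subdiagonals_subset:
  assumes "l \<in> subdiagonals b n k"
  shows "l \<subseteq> {0..<n} \<times> {0..<n}"
proof
  fix x
  assume x: "x \<in> l"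
  from assms obtain \<sigma> where \<sigma>: "\<sigma> permutes {0..<n}" "l \<subseteq> diagonal n \<sigma>"
    unfolding subdiagonals_def by blast
  then obtain i where "x = (i, \<sigma> i)" "i < n"
    using x unfolding diagonal_def by blast
  then show "x \<in> {0..<n} \<times> {0..<n}"
    using permutes_in_image[OF \<sigma>(1), of i] by simp
qed

section \<open>Action of row exchanges and transposition on subdiagonals\<close>

lemma su_image:
  assumes "inj_on \<pi> l" and "\<And>i j. (i, j) \<in> l \<Longrightarrow> A $$ \<pi> (i, j) = B $$ (i, j)"
  shows "su A (\<pi> ` l) = su B l"
  unfolding su_def sum.reindex[OF assms(1)] by (rule sum.cong) (auto dest: assms(2))

text \<open>An involution of the positions induces an involution of the sets of positions, which
  serves as its own inverse in the reindexing. The map \<open>h\<close> records the effect on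
  parity: \<open>Not\<close> for a row exchange, the identity for transposition.\<close>

lemma sum_subdiagonals_involution:
  assumes "\<And>x. \<pi> (\<pi> x) = x"
    and "\<And>b l. l \<in> subdiagonals b n k \<Longrightarrow> \<pi> ` l \<in> subdiagonals (h b) n k" and "h (h b) = b"
    and "\<And>i j. i < n \<Longrightarrow> j < n \<Longrightarrow> A $$ \<pi> (i, j) = B $$ (i, j)"
  shows "(\<Sum>l\<in>subdiagonals b n k. p (su B l)) = (\<Sum>l\<in>subdiagonals (h b) n k. p (su A l))"
proof (rule sum.reindex_bij_witness[where i = "image \<pi>" and j = "image \<pi>"])
  show "\<pi> ` \<pi> ` l = l" for l
    by (simp only: image_image assms(1) image_ident)
  then show "\<pi> ` \<pi> ` l = l" for l .
  show "\<pi> ` l \<in> subdiagonals b n k" if "l \<in> subdiagonals (h b) n k" for l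
    using assms(2)[OF that] by (simp only: assms(3))
  fix l
  assume l: "l \<in> subdiagonals b n k"
  show "\<pi> ` l \<in> subdiagonals (h b) n k"
    by (rule assms(2)[OF l])
  have "inj_on \<pi> l"
    by (metis assms(1) inj_onI)
  moreover have "A $$ \<pi> (i, j) = B $$ (i, j)" if "(i, j) \<in> l" for i j
    using subdiagonals_subset[OF l] that assms(4)[of i j] by auto
  ultimately show "p (su A (\<pi> ` l)) = p (su B l)"
    by (simp add: su_image)
qed

text \<open>Write t for \<open>transpose r s\<close>. As t is an involution, the position (t i,
  \<sigma> i) lies on the graph of \<open>\<sigma> \<circ> t\<close>, a permutation of the opposite
  parity.\<close>

lemma transpose_rows_subdiagonal:
  assumes "r < n" "s < n" "r \<noteq> s" and "l \<in> subdiagonals b n k"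
  shows "map_prod (transpose r s) id ` l \<in> subdiagonals (\<not> b) n k"
proof -
  obtain \<sigma> where \<sigma>: "\<sigma> permutes {0..<n}" "evenperm \<sigma> = b" "l \<subseteq> diagonal n \<sigma>" "card l = k"
    using assms(4) by (auto simp: subdiagonals_def)
  have t: "transpose r s permutes {0..<n}"
    using assms by (intro permutes_swap_id) auto
  have "\<sigma> \<circ> transpose r s permutes {0..<n}"
    by (rule permutes_compose[OF t \<sigma>(1)])
  moreover have "evenperm (\<sigma> \<circ> transpose r s) = (\<not> b)"
    using \<sigma> t assms(3) evenperm_comp[of \<sigma> "transpose r s"]
    by (auto simp: evenperm_swap permutes_imp_permutation[OF finite_atLeastLessThan])
  moreover have "map_prod (transpose r s) id ` l \<subseteq> diagonal n (\<sigma> \<circ> transpose r s)"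
  proof (rule image_subsetI)
    fix x
    assume "x \<in> l"
    then obtain i where i: "x = (i, \<sigma> i)" "i < n"
      using \<sigma>(3) by (auto simp: diagonal_def)
    then have "transpose r s i < n"
      using permutes_in_image[OF t, of i] by simp
    then show "map_prod (transpose r s) id x \<in> diagonal n (\<sigma> \<circ> transpose r s)"
      using i by (auto simp: diagonal_def)
  qed
  moreover have "card (map_prod (transpose r s) id ` l) = k"
    using \<sigma>(4) by (simp add: card_image prod.inj_map inj_on_subset[OF _ subset_UNIV])
  ultimately show ?thesis
    unfolding subdiagonals_def by blast
qed

text \<open>Exchanging coordinates turns the graph of \<sigma> into that of its inverse, which has
  the same parity.\<close>

lemma transpose_subdiagonal:
  assumes "l \<in> subdiagonals b n k"
  shows "prod.swap ` l \<in> subdiagonals b n k"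
proof -
  obtain \<sigma> where \<sigma>: "\<sigma> permutes {0..<n}" "evenperm \<sigma> = b" "l \<subseteq> diagonal n \<sigma>" "card l = k"
    using assms by (auto simp: subdiagonals_def)
  have "prod.swap ` l \<subseteq> diagonal n (Hilbert_Choice.inv \<sigma>)"
  proof (rule image_subsetI)
    fix x
    assume "x \<in> l"
    then obtain i where i: "x = (i, \<sigma> i)" "i < n"
      using \<sigma>(3) by (auto simp: diagonal_def)
    then show "prod.swap x \<in> diagonal n (Hilbert_Choice.inv \<sigma>)"
      using permutes_in_image[OF \<sigma>(1), of i] permutes_inverses[OF \<sigma>(1)]
      by (auto simp: diagonal_def)
  qed
  moreover have "evenperm (Hilbert_Choice.inv \<sigma>) = b"
    using \<sigma> by (simp add: evenperm_inv permutes_imp_permutation[OF finite_atLeastLessThan])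
  moreover have "card (prod.swap ` l) = k"
    using \<sigma>(4) by (simp add: card_image)
  ultimately show ?thesis
    unfolding subdiagonals_def using permutes_inv[OF \<sigma>(1)] by blast
qed

section \<open>Enumerating the subdiagonals of lengths n and n - 1 by permutations\<close>

lemma diagonal_eq: "diagonal n \<sigma> = (\<lambda>j. (j, \<sigma> j)) ` {0..<n}"
  by (auto simp: diagonal_def)

lemma diagonal_minus_eq:
  "diagonal n \<sigma> - {(i, \<sigma> i)} = (\<lambda>j. (j, \<sigma> j)) ` ({0..<n} - {i})"
  unfolding diagonal_eq by blast

lemma su_graph: "su A ((\<lambda>j. (j, \<sigma> j)) ` S) = (\<Sum>j\<in>S. A $$ (j, \<sigma> j))"
  unfolding su_def by (subst sum.reindex) (auto simp: inj_on_def)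

lemma card_diagonal: "card (diagonal n \<sigma>) = n"
  unfolding diagonal_eq by (subst card_image) (auto simp: inj_on_def)

lemma finite_diagonal: "finite (diagonal n \<sigma>)"
  unfolding diagonal_eq by simp

text \<open>A subset of n positions exhausts a diagonal, and a diagonal determines its permutation,
  since permutations of \<open>{0..<n}\<close> agree outside that set.\<close>

lemma sum_full_subdiagonals:
  "(\<Sum>l\<in>subdiagonals b n n. g l) =
   (\<Sum>\<sigma> | \<sigma> permutes {0..<n} \<and> evenperm \<sigma> = b. g (diagonal n \<sigma>))"
proof -
  have "\<sigma> = \<tau>" if "\<sigma> permutes {0..<n}" "\<tau> permutes {0..<n}" "diagonal n \<sigma> = diagonal n \<tau>" for \<sigma> \<tau>
  proof
    fix i
    show "\<sigma> i = \<tau> i"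
    proof (cases "i < n")
      case True
      then have "(i, \<sigma> i) \<in> diagonal n \<tau>"
        using that(3) by (auto simp: diagonal_def)
      then show ?thesis
        by (auto simp: diagonal_def)
    qed (use that in \<open>simp add: permutes_not_in\<close>)
  qed
  then have "inj_on (diagonal n) {\<sigma>. \<sigma> permutes {0..<n} \<and> evenperm \<sigma> = b}"
    by (auto simp: inj_on_def)
  moreover have "l \<subseteq> diagonal n \<sigma> \<and> card l = n \<longleftrightarrow> l = diagonal n \<sigma>" for l \<sigma>
    using card_subset_eq[OF finite_diagonal, of l n \<sigma>] by (auto simp: card_diagonal)
  then have "subdiagonals b n n = diagonal n ` {\<sigma>. \<sigma> permutes {0..<n} \<and> evenperm \<sigma> = b}"
    unfolding subdiagonals_def by blast
  ultimately show ?thesis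
    by (simp add: sum.reindex)
qed

text \<open>The composite of \<sigma> with the inverse of \<tau> fixes every point other than
  \<open>i\<close>, so it permutes a singleton and is the identity.\<close>

lemma permutes_eqI_except_one:
  assumes "\<sigma> permutes S" "\<tau> permutes S" and eq: "\<And>j. j \<noteq> i \<Longrightarrow> \<sigma> j = \<tau> j"
  shows "\<sigma> = \<tau>"
proof -
  have "Hilbert_Choice.inv \<tau> \<circ> \<sigma> permutes {i}"
  proof (rule permutes_superset)
    show "Hilbert_Choice.inv \<tau> \<circ> \<sigma> permutes S"
      using assms by (simp add: permutes_compose permutes_inv)
    show "(Hilbert_Choice.inv \<tau> \<circ> \<sigma>) x = x" if "x \<in> S - {i}" for x
      using that eq permutes_inverses(2)[OF assms(2)] by auto
  qed
  then have "Hilbert_Choice.inv \<tau> (\<sigma> x) = x" for x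
    by (metis comp_apply id_apply permutes_sing)
  then show ?thesis
    using permutes_inverses(1)[OF assms(2)] by (metis ext)
qed

text \<open>A permutation of \<open>n\<close> points is determined by its values at \<open>n - 1\<close> of them, so a subdiagonal
  of length \<open>n - 1\<close> belongs to only one diagonal.\<close>

lemma sum_corank_one_subdiagonals:
  assumes "n \<ge> 1"
  shows "(\<Sum>l\<in>subdiagonals b n (n - 1). g l) =
   (\<Sum>i<n. \<Sum>\<sigma> | \<sigma> permutes {0..<n} \<and> evenperm \<sigma> = b. g (diagonal n \<sigma> - {(i, \<sigma> i)}))"
proof -
  let ?P = "{\<sigma>. \<sigma> permutes {0..<n} \<and> evenperm \<sigma> = b}"
  let ?f = "\<lambda>(i, \<sigma>). diagonal n \<sigma> - {(i, \<sigma> i)}"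
  have "inj_on ?f ({..<n} \<times> ?P)"
  proof (rule inj_onI, clarify)
    fix i j \<sigma> \<tau>
    assume *: "i < n" "j < n" "\<sigma> permutes {0..<n}" "\<tau> permutes {0..<n}"
      and eq: "diagonal n \<sigma> - {(i, \<sigma> i)} = diagonal n \<tau> - {(j, \<tau> j)}"
    then have eq': "(\<lambda>k. (k, \<sigma> k)) ` ({0..<n} - {i}) = (\<lambda>k. (k, \<tau> k)) ` ({0..<n} - {j})"
      by (simp add: diagonal_minus_eq)
    \<comment> \<open>The rows that occur are all but the deleted one, so projecting to first
      coordinates recovers the deleted row.\<close>
    then have "fst ` (\<lambda>k. (k, \<sigma> k)) ` ({0..<n} - {i}) = fst ` (\<lambda>k. (k, \<tau> k)) ` ({0..<n} - {j})"
      by (rule arg_cong)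
    then have "{0..<n} - {i} = {0..<n} - {j}"
      by (simp only: image_image fst_conv image_ident)
    then have "i \<notin> {0..<n} - {j}"
      by (metis Diff_iff insertI1)
    then have ij: "i = j"
      using * by simp
    have "\<sigma> k = \<tau> k" if "k \<noteq> i" for k
    proof (cases "k < n")
      case True
      then have "(k, \<sigma> k) \<in> (\<lambda>k. (k, \<tau> k)) ` ({0..<n} - {j})"
        unfolding eq'[symmetric] using that by auto
      then show ?thesis
        by auto
    qed (use * in \<open>simp add: permutes_not_in\<close>)
    then have "\<sigma> = \<tau>"
      using * by (intro permutes_eqI_except_one[of _ "{0..<n}" _ i]) auto
    with ij show "i = j \<and> \<sigma> = \<tau>" ..
  qed
  moreover have "subdiagonals b n (n - 1) = ?f ` ({..<n} \<times> ?P)"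
  proof (intro equalityI subsetI)
    fix l
    assume "l \<in> subdiagonals b n (n - 1)"
    then obtain \<sigma> where \<sigma>: "\<sigma> \<in> ?P" "l \<subseteq> diagonal n \<sigma>" "card l = n - 1"
      by (auto simp: subdiagonals_def)
    \<comment> \<open>The assumption \<open>n \<ge> 1\<close> matters: subtraction is truncated, and
      \<open>n - (n - 1)\<close> would be 0 for \<open>n = 0\<close>.\<close>
    then have "card (diagonal n \<sigma> - l) = 1"
      using assms finite_subset[OF \<sigma>(2) finite_diagonal]
      by (simp add: card_Diff_subset card_diagonal)
    then obtain x where x: "diagonal n \<sigma> - l = {x}"
      by (auto simp: card_1_singleton_iff)
    then obtain i where "x = (i, \<sigma> i)" "i < n"
      by (auto simp: diagonal_def)
    moreover have "l = diagonal n \<sigma> - {x}"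
      using x \<sigma>(2) by auto
    ultimately show "l \<in> ?f ` ({..<n} \<times> ?P)"
      using \<sigma>(1) by (intro image_eqI[of _ _ "(i, \<sigma>)"]) auto
  next
    fix l
    assume "l \<in> ?f ` ({..<n} \<times> ?P)"
    then obtain i \<sigma> where i: "i < n" "\<sigma> \<in> ?P" "l = diagonal n \<sigma> - {(i, \<sigma> i)}"
      by auto
    then have "(i, \<sigma> i) \<in> diagonal n \<sigma>"
      by (auto simp: diagonal_def)
    then have "card l = n - 1"
      using i by (simp add: card_diagonal finite_diagonal)
    then show "l \<in> subdiagonals b n (n - 1)"
      using i by (auto simp: subdiagonals_def)
  qed
  ultimately show ?thesis
    by (simp add: sum.reindex sum.cartesian_product case_prod_unfold)
qed


section \<open>Properties valid for every power operation\<close>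

lemma edet_of_transpose:
  assumes "A \<in> carrier_mat n n"
  shows "edet_of pwr (transpose_mat A) = edet_of pwr A"
proof -
  have "(\<Sum>l\<in>subdiagonals b n k. p (su (transpose_mat A) l)) = (\<Sum>l\<in>subdiagonals b n k. p (su A l))"
    for b k and p :: "'a \<Rightarrow> 'a"
  proof (rule sum_subdiagonals_involution[where \<pi> = prod.swap and h = "\<lambda>b. b"])
    show "prod.swap ` l \<in> subdiagonals b n k" if "l \<in> subdiagonals b n k" for b l
      using that by (rule transpose_subdiagonal)
  qed (use assms in simp_all)
  then show ?thesis
    using assms by (simp add: edet_of_eq signed_powers_def)
qed

text \<open>The exchange matches even subdiagonals with odd ones in each length, so every
  \<open>signed_powers\<close> changes sign, and division by the factorial respects signs.\<close>

lemma edet_of_swaprows: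
  fixes mul :: "'a::ab_group_add \<Rightarrow> 'a \<Rightarrow> 'a" and A :: "'a mat"
  assumes "ring_int_division mul" and A: "A \<in> carrier_mat n n" and rs: "r < n" "s < n" "r \<noteq> s"
  shows "edet_of pwr (swaprows r s A) = - edet_of pwr A"
proof -
  have "(\<Sum>l\<in>subdiagonals b n k. p (su (swaprows r s A) l)) = (\<Sum>l\<in>subdiagonals (\<not> b) n k. p (su A l))"
    for b k and p :: "'a \<Rightarrow> 'a"
  proof (rule sum_subdiagonals_involution[where \<pi> = "map_prod (transpose r s) id" and h = Not])
    show "A $$ map_prod (transpose r s) id (i, j) = swaprows r s A $$ (i, j)" if "i < n" "j < n" for i j
      using A rs that by (auto simp: transpose_def)
  qed (use rs transpose_rows_subdiagonal in auto)
  then have "signed_powers p (swaprows r s A) k = - signed_powers p A k" for k and p :: "'a \<Rightarrow> 'a"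
    using A by (simp add: signed_powers_def)
  then have "edet_of pwr (swaprows r s A) = - int_divide (fact n)
      (- (signed_powers (pwr n) A (n - 1) - signed_powers (pwr n) A n))"
    using A by (simp add: edet_of_eq)
  also have "\<dots> = - edet_of pwr A"
    using A by (simp only: int_divide_uminus[OF assms(1) fact_nonzero] edet_of_eq carrier_matD)
  finally show ?thesis .
qed

text \<open>The terms omitting row \<open>k\<close> cancel those of the full diagonals. The terms omitting another row
  \<open>i\<close> do not see the values of \<open>\<sigma>\<close> at \<open>i\<close> and \<open>k\<close>, so exchanging these values cancels them in pairs.\<close>

lemma edet_of_zero_row:
  fixes mul :: "'a::ab_group_add \<Rightarrow> 'a \<Rightarrow> 'a" and A :: "'a mat"
  assumes "ring_int_division mul" and A: "A \<in> carrier_mat n n" and k: "k < n"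
    and zero: "\<And>j. j < n \<Longrightarrow> A $$ (k, j) = 0"
  shows "edet_of pwr A = 0"
proof -
  let ?P = "\<lambda>b. {\<sigma>. \<sigma> permutes {0..<n} \<and> evenperm \<sigma> = b}"
  define g where "g i \<sigma> = pwr n (su A (diagonal n \<sigma> - {(i, \<sigma> i)}))" for i \<sigma>
  have n: "n \<ge> 1"
    using k by simp
  have zero': "A $$ (k, \<sigma> k) = 0" if "\<sigma> \<in> ?P b" for \<sigma> b
    using that k permutes_in_image[of \<sigma> "{0..<n}" k] by (intro zero) auto
  \<comment> \<open>The zero row contributes nothing, so the sum does not see the value of \<sigma>
    at \<open>k\<close> either. The case \<open>i = k\<close> is included and gives the terms that
    meet the full diagonals.\<close>
  have su_minus: "su A (diagonal n \<sigma> - {(i, \<sigma> i)}) = (\<Sum>j\<in>{0..<n} - {i, k}. A $$ (j, \<sigma> j))"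
    if "\<sigma> \<in> ?P b" for \<sigma> b i
    unfolding diagonal_minus_eq su_graph
    using zero'[OF that] by (intro sum.mono_neutral_right) auto
  have same_row: "(\<Sum>\<sigma>\<in>?P b. g k \<sigma>) = (\<Sum>l\<in>subdiagonals b n n. pwr n (su A l))" for b
    unfolding sum_full_subdiagonals
  proof (rule sum.cong[OF refl])
    fix \<sigma>
    assume \<sigma>: "\<sigma> \<in> ?P b"
    have "su A (diagonal n \<sigma>) = (\<Sum>j\<in>{0..<n} - {k}. A $$ (j, \<sigma> j))"
      unfolding diagonal_eq su_graph using zero'[OF \<sigma>] by (intro sum.mono_neutral_right) auto
    then show "g k \<sigma> = pwr n (su A (diagonal n \<sigma>))"
      unfolding g_def su_minus[OF \<sigma>] by simp
  qed
  have other_row: "(\<Sum>\<sigma>\<in>?P True. g i \<sigma>) = (\<Sum>\<sigma>\<in>?P False. g i \<sigma>)" if i: "i < n" "i \<noteq> k" for i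
  proof -
    have t: "transpose i k permutes {0..<n}"
      using i k by (intro permutes_swap_id) auto
    have maps: "\<sigma> \<circ> transpose i k \<in> ?P (\<not> b)" if "\<sigma> \<in> ?P b" for \<sigma> b
      using that t i evenperm_comp[of \<sigma> "transpose i k"]
      by (auto simp: evenperm_swap permutes_compose permutes_imp_permutation[OF finite_atLeastLessThan])
    show ?thesis
    proof (rule sum.reindex_bij_witness[where i = "\<lambda>\<sigma>. \<sigma> \<circ> transpose i k" and j = "\<lambda>\<sigma>. \<sigma> \<circ> transpose i k"])
      fix \<sigma>
      assume \<sigma>: "\<sigma> \<in> ?P True"
      show "\<sigma> \<circ> transpose i k \<in> ?P False"
        using maps[OF \<sigma>] by simp
      show "g i (\<sigma> \<circ> transpose i k) = g i \<sigma>"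
        unfolding g_def su_minus[OF \<sigma>] su_minus[OF maps[OF \<sigma>]]
        by (intro arg_cong[of _ _ "pwr n"] sum.cong) (auto simp: transpose_def)
    next
      fix \<sigma>
      assume "\<sigma> \<in> ?P False"
      from maps[OF this] show "\<sigma> \<circ> transpose i k \<in> ?P True"
        by simp
    qed (auto simp: comp_assoc)
  qed
  have "(\<Sum>l\<in>subdiagonals b n (n - 1). pwr n (su A l)) =
      (\<Sum>\<sigma>\<in>?P b. g k \<sigma>) + (\<Sum>i\<in>{..<n} - {k}. \<Sum>\<sigma>\<in>?P b. g i \<sigma>)" for b
    unfolding sum_corank_one_subdiagonals[OF n] g_def by (rule sum.remove) (use k in auto)
  moreover have "(\<Sum>i\<in>{..<n} - {k}. \<Sum>\<sigma>\<in>?P True. g i \<sigma>) = (\<Sum>i\<in>{..<n} - {k}. \<Sum>\<sigma>\<in>?P False. g i \<sigma>)"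
    by (rule sum.cong) (auto simp: other_row[simplified])
  ultimately have "signed_powers (pwr n) A (n - 1) = signed_powers (pwr n) A n"
    using A by (simp add: signed_powers_def same_row)
  then show ?thesis
    using A by (simp add: edet_of_eq int_divide_zero[OF assms(1)])
qed

section \<open>From rows to columns, and from antisymmetry to equal lines\<close>

lemma transpose_invariant_edet_of: "transpose_invariant n (edet_of pwr)"
  unfolding transpose_invariant_def by (intro ballI edet_of_transpose[symmetric])

lemma antisymmetric_edet_of:
  fixes mul :: "'a::ab_group_add \<Rightarrow> 'a \<Rightarrow> 'a" and pwr :: "nat \<Rightarrow> 'a \<Rightarrow> 'a"
  assumes "ring_int_division mul"
  shows "antisymmetric_mat_fun n (edet_of pwr)"
  unfolding antisymmetric_mat_fun_def
proof (intro ballI allI impI conjI)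
  fix A :: "'a mat" and k l
  assume A: "A \<in> carrier_mat n n" and kl: "k < n" "l < n" "k \<noteq> l"
  show "edet_of pwr (swaprows k l A) = - edet_of pwr A"
    by (rule edet_of_swaprows[OF assms A kl])
  \<comment> \<open>A column exchange is a row exchange conjugated by transposition.\<close>
  have "edet_of pwr (swapcols k l A) = edet_of pwr (swaprows k l (transpose_mat A))"
    using A edet_of_transpose[of "swaprows k l (transpose_mat A)" n]
    by (simp add: swapcols_is_transp_swap_rows[OF A kl(1,2)])
  also have "\<dots> = - edet_of pwr (transpose_mat A)"
    using A kl by (intro edet_of_swaprows[OF assms]) auto
  finally show "edet_of pwr (swapcols k l A) = - edet_of pwr A"
    by (simp add: edet_of_transpose[OF A])
qed

text \<open>Exchanging two equal lines leaves the matrix unchanged, so by antisymmetry the value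
  equals its own negative.\<close>

lemma vanishes_equal_lines_edet_of:
  fixes mul :: "'a::ab_group_add \<Rightarrow> 'a \<Rightarrow> 'a" and pwr :: "nat \<Rightarrow> 'a \<Rightarrow> 'a"
  assumes "ring_int_division mul"
  shows "vanishes_equal_lines n (edet_of pwr)"
  unfolding vanishes_equal_lines_def
proof (intro ballI allI impI)
  fix A :: "'a mat" and k l
  assume A: "A \<in> carrier_mat n n" and kl: "k < n" "l < n" "k \<noteq> l"
    and eq: "row A k = row A l \<or> col A k = col A l"
  have anti: "edet_of pwr (swaprows k l A) = - edet_of pwr A"
    "edet_of pwr (swapcols k l A) = - edet_of pwr A"
    using antisymmetric_edet_of[OF assms] A kl by (auto simp: antisymmetric_mat_fun_def)
  have "swaprows k l A = A" if "row A k = row A l"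
  proof (rule eq_matI)
    fix i j
    assume ij: "i < dim_row A" "j < dim_col A"
    have "A $$ (k, j) = A $$ (l, j)"
      using arg_cong[OF that, of "\<lambda>v. v $ j"] A kl ij by simp
    then show "swaprows k l A $$ (i, j) = A $$ (i, j)"
      using A kl ij by auto
  qed auto
  moreover have "swapcols k l A = A" if "col A k = col A l"
  proof (rule eq_matI)
    fix i j
    assume ij: "i < dim_row A" "j < dim_col A"
    have "A $$ (i, k) = A $$ (i, l)"
      using arg_cong[OF that, of "\<lambda>v. v $ i"] A kl ij by simp
    then show "swapcols k l A $$ (i, j) = A $$ (i, j)"
      using A kl ij by auto
  qed auto
  ultimately have "edet_of pwr A = - edet_of pwr A"
    using eq anti by metis
  then show "edet_of pwr A = 0"
    by (rule eq_uminus_self_imp_zero[OF assms])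
qed

lemma vanishes_zero_line_edet_of:
  fixes mul :: "'a::ab_group_add \<Rightarrow> 'a \<Rightarrow> 'a" and pwr :: "nat \<Rightarrow> 'a \<Rightarrow> 'a"
  assumes "ring_int_division mul"
  shows "vanishes_zero_line n (edet_of pwr)"
  unfolding vanishes_zero_line_def
proof (intro ballI allI impI)
  fix A :: "'a mat" and k
  assume A: "A \<in> carrier_mat n n" and k: "k < n" and eq: "row A k = 0\<^sub>v n \<or> col A k = 0\<^sub>v n"
  have rows: "edet_of pwr B = 0" if B: "B \<in> carrier_mat n n" and eq: "row B k = 0\<^sub>v n" for B
  proof (rule edet_of_zero_row[OF assms B k])
    show "B $$ (k, j) = 0" if "j < n" for j
      using arg_cong[OF eq, of "\<lambda>v. v $ j"] B k that by simp
  qed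
  \<comment> \<open>A zero column of \<open>A\<close> is a zero row of its transpose.\<close>
  have "edet_of pwr (transpose_mat A) = 0" if "col A k = 0\<^sub>v n"
    using that A k by (intro rows) simp_all
  then show "edet_of pwr A = 0"
    using eq rows[OF A] edet_of_transpose[OF A, of pwr] by metis
qed


section \<open>Counterexamples from triangular matrices\<close>

text \<open>The triple \<open>(a, b, c)\<close> stands for the matrix with rows \<open>(a, b)\<close> and \<open>(0, c)\<close>; the fourth
  component is a direct summand with zero multiplication.\<close>

definition triangular_mul :: "rat4 \<Rightarrow> rat4 \<Rightarrow> rat4" where
  "triangular_mul = (\<lambda>(x1, x2, x3, x4) (y1, y2, y3, y4). (x1 * y1, x1 * y2 + x2 * y3, x3 * y3, 0))"

lemma triangular_mul_assoc:
  "triangular_mul (triangular_mul x y) z = triangular_mul x (triangular_mul y z)"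
  by (cases x; cases y; cases z) (simp add: triangular_mul_def algebra_simps)

lemma int_multiple_rat4:
  "int_multiple m (a, b, c, d) =
    (of_int m * a, of_int m * b, of_int m * c, of_int m * d :: rat)"
proof -
  have "(\<Sum>i<k. (a, b, c, d)) = (of_nat k * a, of_nat k * b, of_nat k * c, of_nat k * d :: rat)" for k :: nat
    by (induction k) (simp_all add: zero_prod_def algebra_simps)
  then show ?thesis
    by (simp add: int_multiple_def)
qed

lemma ring_int_division_triangular_mul: "ring_int_division triangular_mul"
  unfolding ring_int_division_def
proof (intro conjI allI impI)
  show "biadditive triangular_mul"
    by (auto simp: biadditive_def triangular_mul_def algebra_simps)
  fix m :: int
  assume "m \<noteq> 0"
  then show "bij (int_multiple m :: rat4 \<Rightarrow> rat4)"
    by (intro bij_betw_byWitness[where f' = "\<lambda>(a, b, c, d).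
      (a / of_int m, b / of_int m, c / of_int m, d / of_int m)"]) (auto simp: int_multiple_rat4)
qed

section \<open>Powers and bracketings\<close>

lemma ring_power_add:
  assumes "\<And>x y z. mul (mul x y) z = mul x (mul y z)" and "m \<ge> 1" "n \<ge> 1"
  shows "mul (ring_power mul m a) (ring_power mul n a) = ring_power mul (m + n) a"
  using assms(3)
\<comment> \<open>The induction starts at 1, because \<open>ring_power mul 0 a\<close> is the
  default value 0 and not a unit.\<close>
proof (induction n rule: dec_induct)
  case base
  then show ?case
    using assms(2) by (cases m) auto
next
  case (step n)
  then obtain k where "n = Suc k"
    by (cases n) auto
  then show ?case
    using step assms(1)[of "ring_power mul m a" "ring_power mul n a" a] by simp
qed

lemma factors_ge_1: "factors t \<ge> 1"
  by (induction t) auto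

text \<open>By induction on the tree, every bracketing evaluates to the left-normed power, which
  depends only on the number of factors.\<close>

lemma associative_imp_associative_powers:
  assumes "\<And>x y z :: 'a::ab_group_add. mul (mul x y) z = mul x (mul y z)"
  shows "associative_powers mul"
proof -
  have "bracket_power mul a t = ring_power mul (factors t) a" for a t
    using ring_power_add[of mul, OF assms factors_ge_1 factors_ge_1] by (induction t) simp_all
  then show ?thesis
    by (simp add: associative_powers_def)
qed

lemma factors_eq_1_iff: "factors t = Suc 0 \<longleftrightarrow> t = Factor"
proof (cases t)
  case (Prod u v)
  then show ?thesis
    using factors_ge_1[of u] factors_ge_1[of v] by auto
qed simp

lemma factors_eq_2_iff: "factors t = 2 \<longleftrightarrow> t = Prod Factor Factor"
proof (cases t)
  case (Prod u v)
  then have "factors t = 2 \<longleftrightarrow> factors u = Suc 0 \<and> factors v = Suc 0"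
    using factors_ge_1[of u] factors_ge_1[of v] by auto
  then show ?thesis
    using Prod by (simp add: factors_eq_1_iff)
qed simp

text \<open>With one factor, and likewise with two, there is a single bracketing and
  \<open>bracketing_count\<close> is 1, so averaging changes nothing. This lets the same
  counterexamples serve \<open>edet\<close> and \<open>edet_Ass\<close>.\<close>

lemma Ass_power_1:
  assumes "ring_int_division mul"
  shows "Ass_power mul 1 a = a"
  using int_divide_eqI[OF assms _ int_multiple_one]
  by (simp add: Ass_power_def bracketing_count_def factors_eq_1_iff)

lemma Ass_power_2:
  assumes "ring_int_division mul"
  shows "Ass_power mul 2 a = mul a a"
  using int_divide_eqI[OF assms _ int_multiple_one]
  by (simp add: Ass_power_def bracketing_count_def factors_eq_2_iff)

section \<open>Values of the determinant in sizes 1 and 2\<close>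

lemma permutes_1: "{\<sigma>. \<sigma> permutes {0..<1::nat} \<and> evenperm \<sigma> = b} = (if b then {id} else {})"
proof -
  have "{0..<1::nat} = {0}"
    by auto
  then have "\<sigma> permutes {0..<1::nat} \<longleftrightarrow> \<sigma> = id" for \<sigma>
    by (simp only: permutes_sing)
  moreover have "{\<sigma> :: nat \<Rightarrow> nat. \<sigma> = id \<and> evenperm \<sigma> = b} = (if b then {id} else {})"
    using evenperm_id by auto
  ultimately show ?thesis
    by (simp only:)
qed

text \<open>This evaluates the minors in the Laplace expansion of a 2 by 2 matrix.\<close>

lemma edet_of_1:
  fixes mul :: "'a::ab_group_add \<Rightarrow> 'a \<Rightarrow> 'a" and A :: "'a mat"
  assumes "ring_int_division mul" and A: "A \<in> carrier_mat 1 1" and pwr: "\<And>x. pwr 1 x = x"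
  shows "edet_of pwr A = A $$ (0, 0)"
proof -
  have dim: "dim_row A = 1"
    using A by simp
  have id: "diagonal 1 id = {(0, 0)}"
    by (auto simp: diagonal_def)
  \<comment> \<open>The only subdiagonal of length 0 is empty and even; its \<open>su\<close> is 0,
    whose first power is 0.\<close>
  have "signed_powers (pwr 1) A (1 - 1) = 0"
    unfolding signed_powers_def dim sum_corank_one_subdiagonals[OF le_refl] permutes_1 pwr
    by (simp add: id[simplified] su_def)
  moreover have "signed_powers (pwr 1) A 1 = A $$ (0, 0)"
    unfolding signed_powers_def dim sum_full_subdiagonals permutes_1 pwr
    by (simp add: id[simplified] su_def)
  moreover have "int_divide 1 (- x) = - x" for x :: 'a
    by (rule int_divide_eqI[OF assms(1) _ int_multiple_one]) simp
  ultimately show ?thesis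
    unfolding edet_of_eq dim by simp
qed

lemma permutes_2:
  "{\<sigma>. \<sigma> permutes {0..<2::nat} \<and> evenperm \<sigma> = b} = (if b then {id} else {transpose 0 1})"
proof -
  have "{0..<2::nat} = {0, 1}"
    by auto
  then have "\<sigma> permutes {0..<2::nat} \<longleftrightarrow> \<sigma> \<in> {id, transpose 0 1}" for \<sigma>
    by (simp only: permutes_doubleton_iff insert_iff empty_iff) simp
  moreover have "\<not> evenperm (transpose 0 (1 :: nat))"
    by (simp add: evenperm_swap)
  ultimately show ?thesis
    by (auto simp only: evenperm_id insert_iff empty_iff split: if_splits)
qed

text \<open>The squares of single entries from length 1 cancel those in the expanded squares of the
  two diagonal sums, leaving the mixed products in both orders. Doubling the determinant keeps the
  division by 2 out of the formula.\<close>

lemma edet_of_2: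
  assumes "ring_int_division mul" and A: "A \<in> carrier_mat 2 2" and pwr: "\<And>x. pwr 2 x = mul x x"
  shows "edet_of pwr A + edet_of pwr A =
    mul (A $$ (0, 0)) (A $$ (1, 1)) + mul (A $$ (1, 1)) (A $$ (0, 0))
    - mul (A $$ (0, 1)) (A $$ (1, 0)) - mul (A $$ (1, 0)) (A $$ (0, 1))"
    (is "_ = ?r")
proof -
  have dim: "dim_row A = 2"
    using A by simp
  have id: "diagonal 2 id = {(0, 0), (1, 1)}" and tr: "diagonal 2 (transpose 0 1) = {(0, 1), (1, 0)}"
    by (auto simp: diagonal_def less_2_cases_iff)
  have two: "{..<2 :: nat} = {0, 1}"
    by auto
  have add: "mul (x + y) z = mul x z + mul y z" "mul x (y + z) = mul x y + mul x z" for x y z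
    using assms(1) by (auto simp: ring_int_division_def biadditive_def)
  have "signed_powers (pwr 2) A (2 - 1) =
      mul (A $$ (0, 0)) (A $$ (0, 0)) + mul (A $$ (1, 1)) (A $$ (1, 1))
    - (mul (A $$ (0, 1)) (A $$ (0, 1)) + mul (A $$ (1, 0)) (A $$ (1, 0)))"
    unfolding signed_powers_def dim sum_corank_one_subdiagonals[OF one_le_numeral] permutes_2 pwr two
    by (simp add: id[simplified] tr[simplified] su_def insert_Diff_if)
  moreover have "signed_powers (pwr 2) A 2 =
      mul (A $$ (0, 0) + A $$ (1, 1)) (A $$ (0, 0) + A $$ (1, 1))
    - mul (A $$ (0, 1) + A $$ (1, 0)) (A $$ (0, 1) + A $$ (1, 0))"
    unfolding signed_powers_def dim sum_full_subdiagonals permutes_2 pwr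
    by (simp add: id[simplified] tr[simplified] su_def)
  ultimately have "signed_powers (pwr 2) A (2 - 1) - signed_powers (pwr 2) A 2 = - ?r"
    by (simp only:) (simp add: add)
  then have "edet_of pwr A = - int_divide 2 (- ?r)"
    unfolding edet_of_eq dim by (simp only: fact_2)
  also have "\<dots> = int_divide 2 ?r"
    by (simp only: int_divide_uminus[OF assms(1)] minus_minus)
  finally have "edet_of pwr A = int_divide 2 ?r" .
  then show ?thesis
    using int_multiple_int_divide[OF assms(1), of 2 ?r] by (simp only: int_multiple_two)
qed

text \<open>Matrices of size 2 and their minors involve only first and second powers, so fixing
  these two covers both determinants at once.\<close>

lemma triangular_counterexamples:
  fixes pwr :: "nat \<Rightarrow> rat4 \<Rightarrow> rat4"
  assumes pwr1: "\<And>x. pwr 1 x = x" and pwr2: "\<And>x. pwr 2 x = triangular_mul x x"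
  shows "\<not> laplace_rows 2 triangular_mul (edet_of pwr)"
    and "\<not> laplace_cols 2 triangular_mul (edet_of pwr)"
    and "\<not> multiplicative_mat_fun 2 triangular_mul (edet_of pwr)"
proof -
  define diag :: "rat4 \<Rightarrow> rat4 \<Rightarrow> rat4 mat" where
    "diag p q = mat 2 2 (\<lambda>(i, j). if i = j then if i = 0 then p else q else 0)" for p q
  \<comment> \<open>This undoes the doubling in \<open>edet_of_2\<close>, one rational component at
    a time.\<close>
  have halve: "x = (a / 2, b / 2, c / 2, d / 2)" if "x + x = (a, b, c, d)" for x :: rat4 and a b c d
    using that by (cases x) (auto simp: field_simps)
  have zero: "triangular_mul 0 x = 0" "triangular_mul x 0 = 0" for x
    by (auto simp: triangular_mul_def zero_prod_def split: prod.splits)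
  have two: "{..<2 :: nat} = {0, 1}"
    by auto
  have diag_carrier: "diag p q \<in> carrier_mat 2 2" for p q
    by (simp add: diag_def)
  have entries: "diag p q $$ (0, 0) = p" "diag p q $$ (1, 1) = q" "diag p q $$ (0, 1) = 0"
    "diag p q $$ (1, 0) = 0" for p q
    by (simp_all add: diag_def)
  have D2: "edet_of pwr (diag p q) + edet_of pwr (diag p q) = triangular_mul p q + triangular_mul q p" for p q
    using edet_of_2[where pwr = pwr and mul = triangular_mul, OF ring_int_division_triangular_mul
      diag_carrier[of p q] pwr2] by (simp only: entries zero diff_zero)
  have D1: "edet_of pwr (mat_delete (diag p q) i j) = mat_delete (diag p q) i j $$ (0, 0)" for p q i j
    by (rule edet_of_1[where pwr = pwr, OF ring_int_division_triangular_mul _ pwr1])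
      (simp add: diag_def mat_delete_def)
  have deleted: "mat_delete (diag p q) 0 0 $$ (0, 0) = q" for p q
    by (simp add: diag_def mat_delete_def)
  \<comment> \<open>These are the identity matrix and the matrix units E11 and E12. The product of
    \<open>?a\<close> and \<open>?b\<close> is \<open>?b\<close> in this order and 0 in the other,
    so the symmetrized product is half of \<open>?b\<close>.\<close>
  let ?one = "(1, 0, 1, 0) :: rat4" and ?a = "(1, 0, 0, 0) :: rat4" and ?b = "(0, 1, 0, 0) :: rat4"
  have ab: "edet_of pwr (diag ?a ?b) = (0, 1 / 2, 0, 0)" "edet_of pwr (diag ?b ?a) = (0, 1 / 2, 0, 0)"
    using halve[OF D2[of ?a ?b, unfolded triangular_mul_def, simplified]]
      halve[OF D2[of ?b ?a, unfolded triangular_mul_def, simplified]] by simp_all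
  have one: "edet_of pwr (diag ?one ?a) = ?a" "edet_of pwr (diag ?b ?one) = ?b"
    using halve[OF D2[of ?one ?a, unfolded triangular_mul_def, simplified]]
      halve[OF D2[of ?b ?one, unfolded triangular_mul_def, simplified]] by simp_all
  show "\<not> laplace_rows 2 triangular_mul (edet_of pwr)"
  proof
    assume "laplace_rows 2 triangular_mul (edet_of pwr)"
    then have "edet_of pwr (diag ?a ?b) = (\<Sum>j<2. int_multiple ((-1) ^ (0 + j))
        (triangular_mul (diag ?a ?b $$ (0, j)) (edet_of pwr (mat_delete (diag ?a ?b) 0 j))))"
      unfolding laplace_rows_def using diag_carrier by (meson pos2)
    \<comment> \<open>Only the diagonal entry of row 0 survives, with sign 1 and minor
      \<open>?b\<close>. The expansion is thus the whole of \<open>?b\<close>, twice the actual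
      value.\<close>
    also have "\<dots> = triangular_mul ?a ?b"
      unfolding two
      by (simp add: entries[simplified] D1 deleted zero int_multiple_zero int_multiple_one)
    finally show False
      by (simp add: ab triangular_mul_def)
  qed
  show "\<not> laplace_cols 2 triangular_mul (edet_of pwr)"
  proof
    assume "laplace_cols 2 triangular_mul (edet_of pwr)"
    then have "edet_of pwr (diag ?a ?b) = (\<Sum>i<2. int_multiple ((-1) ^ (i + 0))
        (triangular_mul (diag ?a ?b $$ (i, 0)) (edet_of pwr (mat_delete (diag ?a ?b) i 0))))"
      unfolding laplace_cols_def using diag_carrier by (meson pos2)
    also have "\<dots> = triangular_mul ?a ?b"
      unfolding two
      by (simp add: entries[simplified] D1 deleted zero int_multiple_zero int_multiple_one)
    finally show False
      by (simp add: ab triangular_mul_def)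
  qed
  show "\<not> multiplicative_mat_fun 2 triangular_mul (edet_of pwr)"
  proof
    assume "multiplicative_mat_fun 2 triangular_mul (edet_of pwr)"
    then have "edet_of pwr (mat_mult 2 triangular_mul (diag ?one ?a) (diag ?b ?one)) =
        triangular_mul (edet_of pwr (diag ?one ?a)) (edet_of pwr (diag ?b ?one))"
      unfolding multiplicative_mat_fun_def using diag_carrier by blast
    moreover have "mat_mult 2 triangular_mul (diag ?one ?a) (diag ?b ?one) = diag ?b ?a"
    proof (rule eq_matI)
      fix i j
      assume "i < dim_row (diag ?b ?a)" "j < dim_col (diag ?b ?a)"
      then have "i = 0 \<or> i = 1" "j = 0 \<or> j = 1"
        using diag_carrier[of ?b ?a] by auto
      then show "mat_mult 2 triangular_mul (diag ?one ?a) (diag ?b ?one) $$ (i, j) = diag ?b ?a $$ (i, j)"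
        unfolding mat_mult_def two
        by (elim disjE) (simp_all add: entries[simplified] zero, simp_all add: triangular_mul_def)
    qed (simp_all add: mat_mult_def diag_def)
    ultimately show False
      by (simp add: ab one triangular_mul_def)
  qed
qed

theorem lemma4:
  fixes mul :: "'a::ab_group_add \<Rightarrow> 'a \<Rightarrow> 'a" and n :: nat
  assumes "ring_int_division mul" and "n \<ge> 1"
  shows
    "(associative_powers mul \<longrightarrow>
        antisymmetric_mat_fun n (edet mul) \<and> vanishes_zero_line n (edet mul) \<and>
        vanishes_equal_lines n (edet mul) \<and> transpose_invariant n (edet mul))
     \<and>
     (antisymmetric_mat_fun n (edet_Ass mul) \<and> vanishes_zero_line n (edet_Ass mul) \<and>
        vanishes_equal_lines n (edet_Ass mul) \<and> transpose_invariant n (edet_Ass mul))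
     \<and>
     \<not> (\<forall>(f :: rat4 \<Rightarrow> rat4 \<Rightarrow> rat4) m.
          ring_int_division f \<and> associative_powers f \<and> m \<ge> 2 \<longrightarrow> laplace_rows m f (edet f)) \<and>
     \<not> (\<forall>(f :: rat4 \<Rightarrow> rat4 \<Rightarrow> rat4) m.
          ring_int_division f \<and> associative_powers f \<and> m \<ge> 2 \<longrightarrow> laplace_cols m f (edet f)) \<and>
     \<not> (\<forall>(f :: rat4 \<Rightarrow> rat4 \<Rightarrow> rat4) m.
          ring_int_division f \<and> associative_powers f \<and> m \<ge> 1 \<longrightarrow>
          multiplicative_mat_fun m f (edet f)) \<and>
     \<not> (\<forall>(f :: rat4 \<Rightarrow> rat4 \<Rightarrow> rat4) m.
          ring_int_division f \<and> associative_powers f \<and> m \<ge> 1 \<longrightarrow>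
          (m \<ge> 2 \<longrightarrow> laplace_rows m f (edet f) \<and> laplace_cols m f (edet f)) \<and>
          polyadditive m (edet f) \<and> multiplicative_mat_fun m f (edet f))
     \<and>
     \<not> (\<forall>(f :: rat4 \<Rightarrow> rat4 \<Rightarrow> rat4) m.
          ring_int_division f \<and> m \<ge> 2 \<longrightarrow> laplace_rows m f (edet_Ass f)) \<and>
     \<not> (\<forall>(f :: rat4 \<Rightarrow> rat4 \<Rightarrow> rat4) m.
          ring_int_division f \<and> m \<ge> 2 \<longrightarrow> laplace_cols m f (edet_Ass f)) \<and>
     \<not> (\<forall>(f :: rat4 \<Rightarrow> rat4 \<Rightarrow> rat4) m.
          ring_int_division f \<and> m \<ge> 1 \<longrightarrow> multiplicative_mat_fun m f (edet_Ass f)) \<and>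
     \<not> (\<forall>(f :: rat4 \<Rightarrow> rat4 \<Rightarrow> rat4) m.
          ring_int_division f \<and> m \<ge> 1 \<longrightarrow>
          (m \<ge> 2 \<longrightarrow> laplace_rows m f (edet_Ass f) \<and> laplace_cols m f (edet_Ass f)) \<and>
          polyadditive m (edet_Ass f) \<and> multiplicative_mat_fun m f (edet_Ass f))"
proof -
  have general: "antisymmetric_mat_fun n (edet_of pwr) \<and> vanishes_zero_line n (edet_of pwr) \<and>
      vanishes_equal_lines n (edet_of pwr) \<and> transpose_invariant n (edet_of pwr)" for pwr :: "nat \<Rightarrow> 'a \<Rightarrow> 'a"
    using antisymmetric_edet_of[OF assms(1)] vanishes_zero_line_edet_of[OF assms(1)]
      vanishes_equal_lines_edet_of[OF assms(1)] transpose_invariant_edet_of by blast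
  note ring = ring_int_division_triangular_mul
    associative_imp_associative_powers[OF triangular_mul_assoc]
  have "ring_power triangular_mul 1 x = x" "ring_power triangular_mul 2 x = triangular_mul x x" for x
    by (simp_all add: numeral_2_eq_2)
  note counter = triangular_counterexamples[OF this, folded edet_def]
  note counter_Ass = triangular_counterexamples[OF Ass_power_1[OF ring(1)] Ass_power_2[OF ring(1)],
      folded edet_Ass_def]
  have two: "(2 :: nat) \<ge> 2" "(2 :: nat) \<ge> 1"
    by simp_all
  \<comment> \<open>All eight refutations take \<open>triangular_mul\<close> and size 2 as
    witnesses. The two conjunctions containing \<open>polyadditive\<close> fail through their
    Laplace or product formulas.\<close>
  show ?thesis
    using general[of "ring_power mul", folded edet_def] general[of "Ass_power mul", folded edet_Ass_def]
      ring two counter counter_Ass by meson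
qed

end
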